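(* Let $\mathcal{N}$ be an $s\times s$ (zero-nonzero) pattern. If $m\geq 2$ and $\mathcal{N}$ is potentially nilpotent, then the pattern $\mathcal{A}_m(\mathcal{N})$ is potentially nilpotent.
   Context: A (zero-nonzero) pattern of order $n$ is an $n\times n$ matrix $\mathcal{A}$ with entries in $\{*,0\}$, and $Q(\mathcal{A})=\{A\in M_n(\mathbb{R}) : A_{i,j}\neq 0 \Leftrightarrow \mathcal{A}_{i,j}=* \text{ for all } i,j\}$. A pattern $\mathcal{A}$ is potentially nilpotent if $Q(\mathcal{A})$ contains a nilpotent matrix. For an $s\times s$ pattern $\mathcal{N}$, $\mathcal{A}_m(\mathcal{N})$ is the $n\times n$ pattern, $n=ms+1$, given in block form by $$\mathcal{A}_m(\mathcal{N})=\begin{bmatrix} 0 & \ell^T & \ell^T & \cdots & \ell^T\\ \ell & \mathcal{N} & 0 & \cdots & 0\\ \ell & 0 & \mathcal{N} & \ddots & \vdots\\ \vdots & \vdots & \ddots & \ddots & 0\\ \ell & 0 & \cdots & 0 & \mathcal{N}\end{bmatrix},$$ with $m$ diagonal blocks $\mathcal{N}$, where $\ell^T=[*\ 0\ \cdots\ 0]$ has length $s$. *)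

theory Defs
  imports Complex_Main "Jordan_Normal_Form.Matrix"
begin

datatype entry = Star | Blank

(* The library's block-matrix operations fill off-diagonal blocks with 0,
   so the pattern entry 0 is made the 0 of the type. *)
instantiation entry :: zero
begin
definition zero_entry :: entry where "0 = Blank"
instance ..
end

type_synonym pattern = "entry mat"

definition pattern_class :: "pattern \<Rightarrow> real mat set" where
  "pattern_class P = {A \<in> carrier_mat (dim_row P) (dim_col P).
     \<forall>i<dim_row P. \<forall>j<dim_col P. A $$ (i,j) \<noteq> 0 \<longleftrightarrow> P $$ (i,j) = Star}"

definition nilpotent_mat :: "'a::semiring_1 mat \<Rightarrow> bool" where
  "nilpotent_mat A \<longleftrightarrow> square_mat A \<and> (\<exists>k>0. A ^\<^sub>m k = 0\<^sub>m (dim_row A) (dim_row A))"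

definition potentially_nilpotent :: "pattern \<Rightarrow> bool" where
  "potentially_nilpotent P \<longleftrightarrow> (\<exists>A\<in>pattern_class P. nilpotent_mat A)"

definition ell :: "nat \<Rightarrow> entry vec" where
  "ell s = vec s (\<lambda>i. if i = 0 then Star else 0)"

(* The 1 x (m * s) row [ell^T ... ell^T] consisting of m copies of ell^T. *)
definition ell_row :: "nat \<Rightarrow> nat \<Rightarrow> pattern" where
  "ell_row m s = mat 1 (m * s) (\<lambda>(i,j). ell s $ (j mod s))"

definition A_pattern :: "nat \<Rightarrow> pattern \<Rightarrow> pattern" where
  "A_pattern m N = four_block_mat
     (0\<^sub>m 1 1) (ell_row m (dim_row N))
     (transpose_mat (ell_row m (dim_row N))) (diag_block_mat (replicate m N))"

lemma A_pattern_carrier: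
  assumes "N \<in> carrier_mat s s"
  shows "A_pattern m N \<in> carrier_mat (m * s + 1) (m * s + 1)"
  using assms
  by (auto simp: A_pattern_def ell_row_def dim_diag_block_mat sum_list_replicate)

end

theory Submission
  imports Defs
begin

text \<open>
  Let \<open>M\<close> be a nilpotent matrix with pattern \<open>N\<close>. The pattern \<open>A_pattern m N\<close> is realised by bordering
  the block diagonal matrix \<open>D\<close> of \<open>m\<close> copies of \<open>M\<close> with a row \<open>u\<close>, whose entries at the
  starts of the blocks are all \<open>1\<close>, and with a column \<open>v\<close>, whose entries there are nonzero weights
  \<open>b\<^sub>0, \<dots>, b\<^sub>m\<^sub>-\<^sub>1\<close> of sum \<open>0\<close>. Such weights exist as soon as \<open>m \<ge> 2\<close>; the ones chosen are
  \<open>1 - m, 1, \<dots>, 1\<close>. All blocks being equal, \<open>u D\<^sup>j v\<close> is the sum of the weights times the corner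
  entry of \<open>M\<^sup>j\<close>, so it is \<open>0\<close> for every \<open>j\<close> (\<open>bordering_replicated_block\<close>).

  Vanishing of all \<open>u D\<^sup>j v\<close> makes the bordered matrix \<open>B\<close> nilpotent (\<open>nilpotent_bordered_mat\<close>).
  Think of \<open>B\<^sup>r\<close> as the sum over all walks of length \<open>r\<close> through the border and the
  interior: an excursion that leaves the border through \<open>u\<close>, makes \<open>j\<close> steps in \<open>D\<close> and returns
  through \<open>v\<close> contributes a factor \<open>u D\<^sup>j v = 0\<close>. The surviving walks visit the border at most once,
  so they contain at most two stretches in \<open>D\<close>, one of which has length at least the nilpotency
  index of \<open>D\<close> once \<open>r\<close> is large.
\<close>

section \<open>Nilpotency of bordered matrices\<close>

lemma pow_mat_Suc_left:
  assumes "(A :: 'a::semiring_1 mat) \<in> carrier_mat n n"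
  shows "A ^\<^sub>m Suc k = A * A ^\<^sub>m k"
proof (induction k)
  case 0
  then show ?case using assms by simp
next
  case (Suc k)
  have "A ^\<^sub>m Suc (Suc k) = (A * A ^\<^sub>m k) * A" using Suc by simp
  also have "\<dots> = A * (A ^\<^sub>m k * A)" using assms by (intro assoc_mult_mat) auto
  finally show ?case by simp
qed

lemma pow_mat_eq_zero_mono:
  assumes A: "(A :: 'a::semiring_1 mat) \<in> carrier_mat n n" and "A ^\<^sub>m k = 0\<^sub>m n n" and "k \<le> l"
  shows "A ^\<^sub>m l = 0\<^sub>m n n"
  using \<open>k \<le> l\<close> by (induction rule: dec_induct) (use assms in auto)

text \<open>
  The powers of a bordered matrix keep the border \<open>u D\<^sup>j\<close>, \<open>D\<^sup>j v\<close> that one passage through the border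
  would give, since the remaining terms contain some \<open>u D\<^sup>i v\<close>. The interior block has no such simple
  form, but on the matrices \<open>D\<^sup>i v\<close> it acts like a power of \<open>D\<close>, and that is all the induction needs.
\<close>
lemma bordered_mat_pow:
  fixes D :: "'a::semiring_1 mat"
  assumes D: "D \<in> carrier_mat d d" and u: "u \<in> carrier_mat q d" and v: "v \<in> carrier_mat d q"
    and uv: "\<And>j. u * (D ^\<^sub>m j * v) = 0\<^sub>m q q"
  shows "\<exists>C\<in>carrier_mat d d.
     four_block_mat (0\<^sub>m q q) u v D ^\<^sub>m Suc j
       = four_block_mat (0\<^sub>m q q) (u * D ^\<^sub>m j) (D ^\<^sub>m j * v) C
     \<and> (\<forall>i. C * (D ^\<^sub>m i * v) = D ^\<^sub>m (j + 1 + i) * v)"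
proof (induction j)
  case 0
  have "D * (D ^\<^sub>m i * v) = D ^\<^sub>m (0 + 1 + i) * v" for i
  proof -
    have "D * (D ^\<^sub>m i * v) = (D * D ^\<^sub>m i) * v"
      by (rule assoc_mult_mat[symmetric]) (use D v in auto)
    then show ?thesis using pow_mat_Suc_left[OF D, of i] by simp
  qed
  moreover have "four_block_mat (0\<^sub>m q q) u v D ^\<^sub>m Suc 0 = four_block_mat (0\<^sub>m q q) u v D"
    using D by simp
  ultimately show ?case using D u v by (intro bexI[of _ D]) auto
next
  case (Suc j)
  then obtain C where C: "C \<in> carrier_mat d d"
    and pow: "four_block_mat (0\<^sub>m q q) u v D ^\<^sub>m Suc j
       = four_block_mat (0\<^sub>m q q) (u * D ^\<^sub>m j) (D ^\<^sub>m j * v) C"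
    and act: "\<And>i. C * (D ^\<^sub>m i * v) = D ^\<^sub>m (j + 1 + i) * v" by blast
  have Dp: "D ^\<^sub>m i \<in> carrier_mat d d" for i using D by simp
  have Dv: "D ^\<^sub>m i * v \<in> carrier_mat d q" for i using Dp v by (rule mult_carrier_mat)
  have uD: "u * D ^\<^sub>m i \<in> carrier_mat q d" for i using u Dp by (rule mult_carrier_mat)
  define C' where "C' = D ^\<^sub>m j * v * u + C * D"
  have C': "C' \<in> carrier_mat d d" unfolding C'_def using Dv u C D by auto
  have "four_block_mat (0\<^sub>m q q) u v D ^\<^sub>m Suc (Suc j)
      = four_block_mat (0\<^sub>m q q) (u * D ^\<^sub>m j) (D ^\<^sub>m j * v) C * four_block_mat (0\<^sub>m q q) u v D"
    unfolding pow[symmetric] by simp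
  also have "\<dots> = four_block_mat (0\<^sub>m q q * 0\<^sub>m q q + u * D ^\<^sub>m j * v) (0\<^sub>m q q * u + u * D ^\<^sub>m j * D)
       (D ^\<^sub>m j * v * 0\<^sub>m q q + C * v) C'"
    unfolding C'_def by (rule mult_four_block_mat[OF _ uD Dv C _ u v D]) auto
  also have "u * D ^\<^sub>m j * v = 0\<^sub>m q q"
    using uv[of j] assoc_mult_mat[OF u Dp v] by simp
  also have "u * D ^\<^sub>m j * D = u * D ^\<^sub>m Suc j"
    using assoc_mult_mat[OF u Dp D] by simp
  also have "C * v = D ^\<^sub>m Suc j * v"
    using act[of 0] D v by simp
  also have "0\<^sub>m q q * 0\<^sub>m q q + 0\<^sub>m q q = (0\<^sub>m q q :: 'a mat)" by simp
  also have "0\<^sub>m q q * u + u * D ^\<^sub>m Suc j = u * D ^\<^sub>m Suc j"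
    using u left_add_zero_mat[OF uD[of "Suc j"]] by (simp add: left_mult_zero_mat)
  also have "D ^\<^sub>m j * v * 0\<^sub>m q q + D ^\<^sub>m Suc j * v = D ^\<^sub>m Suc j * v"
    using left_add_zero_mat[OF Dv[of "Suc j"]] right_mult_zero_mat[OF Dv[of j], of q] by simp
  finally have pow': "four_block_mat (0\<^sub>m q q) u v D ^\<^sub>m Suc (Suc j)
      = four_block_mat (0\<^sub>m q q) (u * D ^\<^sub>m Suc j) (D ^\<^sub>m Suc j * v) C'" .
  have "C' * (D ^\<^sub>m i * v) = D ^\<^sub>m (Suc j + 1 + i) * v" for i
  proof -
    have "C' * (D ^\<^sub>m i * v) = D ^\<^sub>m j * v * u * (D ^\<^sub>m i * v) + C * D * (D ^\<^sub>m i * v)"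
      unfolding C'_def by (rule add_mult_distrib_mat[OF _ _ Dv]) (use Dv u C D in auto)
    also have "D ^\<^sub>m j * v * u * (D ^\<^sub>m i * v) = 0\<^sub>m d q"
      using assoc_mult_mat[OF Dv u Dv, of j i] uv right_mult_zero_mat[OF Dv[of j], of q] by simp
    also have "C * D * (D ^\<^sub>m i * v) = C * (D ^\<^sub>m Suc i * v)"
      using assoc_mult_mat[OF C D Dv, of i] assoc_mult_mat[OF D Dp v, of i]
        pow_mat_Suc_left[OF D, of i] by simp
    also have "C * (D ^\<^sub>m Suc i * v) = D ^\<^sub>m (j + 1 + Suc i) * v" by (rule act)
    also have "j + 1 + Suc i = Suc j + 1 + i" by simp
    finally show ?thesis using left_add_zero_mat[OF Dv[of "Suc j + 1 + i"]] by simp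
  qed
  with C' pow' show ?case by blast
qed

text \<open>
  Once the border blocks of a power have died out, further factors only multiply the interior block by
  \<open>D\<close>; this second stretch of powers of \<open>D\<close> accounts for the exponent \<open>2k + 1\<close> below.
\<close>
lemma nilpotent_bordered_mat:
  fixes D :: "'a::semiring_1 mat"
  assumes D: "D \<in> carrier_mat d d" and u: "u \<in> carrier_mat q d" and v: "v \<in> carrier_mat d q"
    and uv: "\<And>j. u * (D ^\<^sub>m j * v) = 0\<^sub>m q q"
    and nil: "D ^\<^sub>m k = 0\<^sub>m d d"
  shows "nilpotent_mat (four_block_mat (0\<^sub>m q q) u v D)"
proof -
  let ?B = "four_block_mat (0\<^sub>m q q) u v D"
  have Dp: "D ^\<^sub>m i \<in> carrier_mat d d" for i using D by simp
  obtain C where C: "C \<in> carrier_mat d d"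
    and pow: "?B ^\<^sub>m Suc k = four_block_mat (0\<^sub>m q q) (u * D ^\<^sub>m k) (D ^\<^sub>m k * v) C"
    and act: "\<And>i. C * (D ^\<^sub>m i * v) = D ^\<^sub>m (k + 1 + i) * v"
    using bordered_mat_pow[OF D u v uv, of k] by blast
  have act0: "C * (D ^\<^sub>m i * v) = 0\<^sub>m d q" for i
    unfolding act using pow_mat_eq_zero_mono[OF D nil, of "k + 1 + i"] v
    by (simp add: left_mult_zero_mat del: pow_mat.simps)
  have CD: "C * D ^\<^sub>m i \<in> carrier_mat d d" for i using C Dp by (rule mult_carrier_mat)
  have step: "?B ^\<^sub>m (Suc k + i)
      = four_block_mat (0\<^sub>m q q) (0\<^sub>m q d) (0\<^sub>m d q) (C * D ^\<^sub>m i)" for i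
  proof (induction i)
    case 0
    have "u * D ^\<^sub>m k = 0\<^sub>m q d" "D ^\<^sub>m k * v = 0\<^sub>m d q"
      unfolding nil using u v by (simp_all add: left_mult_zero_mat right_mult_zero_mat)
    then show ?case using pow C D by simp
  next
    case (Suc i)
    have "?B ^\<^sub>m (Suc k + Suc i)
        = four_block_mat (0\<^sub>m q q) (0\<^sub>m q d) (0\<^sub>m d q) (C * D ^\<^sub>m i) * ?B"
      unfolding Suc[symmetric] by simp
    also have "\<dots> = four_block_mat (0\<^sub>m q q * 0\<^sub>m q q + 0\<^sub>m q d * v) (0\<^sub>m q q * u + 0\<^sub>m q d * D)
        (0\<^sub>m d q * 0\<^sub>m q q + C * D ^\<^sub>m i * v) (0\<^sub>m d q * u + C * D ^\<^sub>m i * D)"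
      by (rule mult_four_block_mat[OF _ _ _ CD _ u v D]) auto
    also have "C * D ^\<^sub>m i * v = 0\<^sub>m d q"
      using assoc_mult_mat[OF C Dp v, of i] act0[of i] by simp
    also have "C * D ^\<^sub>m i * D = C * D ^\<^sub>m Suc i"
      using assoc_mult_mat[OF C Dp D, of i] by simp
    finally show ?case
      using u v D CD[of "Suc i"] left_add_zero_mat[OF CD[of "Suc i"]]
      by (simp add: left_mult_zero_mat)
  qed
  have "?B ^\<^sub>m (Suc k + k) = 0\<^sub>m (q + d) (q + d)"
    unfolding step nil right_mult_zero_mat[OF C] by simp
  then show ?thesis
    unfolding nilpotent_mat_def using D by (auto intro!: exI[of _ "Suc k + k"] simp del: pow_mat.simps)
qed

section \<open>Bordering equal diagonal blocks\<close>

lemma diag_block_replicate_carrier: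
  assumes "A \<in> carrier_mat s s"
  shows "diag_block_mat (replicate m A) \<in> carrier_mat (m * s) (m * s)"
  using assms by (auto simp: dim_diag_block_mat sum_list_replicate)

lemma diag_block_replicate_index:
  assumes A: "A \<in> carrier_mat s s" and "p < m * s" "r < m * s"
  shows "diag_block_mat (replicate m A) $$ (p, r)
    = (if p div s = r div s then A $$ (p mod s, r mod s) else 0)"
  using assms(2,3)
proof (induction m arbitrary: p r)
  case 0
  then show ?case by simp
next
  case (Suc m)
  have s: "s > 0" using Suc.prems by (cases s) auto
  have D: "diag_block_mat (replicate m A) \<in> carrier_mat (m * s) (m * s)"
    using A by (rule diag_block_replicate_carrier)
  have div: "x div s = Suc ((x - s) div s)" "x mod s = (x - s) mod s" if "\<not> x < s" for x
    using that s by (simp_all add: le_div_geq le_mod_geq)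
  have "diag_block_mat (replicate (Suc m) A) $$ (p, r) =
     (if p < s then if r < s then A $$ (p, r) else 0
      else if r < s then 0 else diag_block_mat (replicate m A) $$ (p - s, r - s))"
    using Suc.prems A D by (auto simp: Let_def)
  also have "\<dots> = (if p div s = r div s then A $$ (p mod s, r mod s) else 0)"
    using Suc.IH[of "p - s" "r - s"] Suc.prems s
    by (cases "p < s"; cases "r < s") (simp_all add: div)
  finally show ?case .
qed

lemma sum_div_mod:
  fixes f :: "nat \<Rightarrow> nat \<Rightarrow> 'a::comm_monoid_add"
  shows "(\<Sum>p<m * s. f (p div s) (p mod s)) = (\<Sum>k<m. \<Sum>i<s. f k i)"
proof -
  have "(\<Sum>p = k * s..<k * s + s. f (p div s) (p mod s)) = (\<Sum>i<s. f k i)" for k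
    using sum.shift_bounds_nat_ivl[of "\<lambda>p. f (p div s) (p mod s)" 0 "k * s" s]
    by (simp add: lessThan_atLeast0 add.commute)
  then show ?thesis
    using sum.nat_group[of "\<lambda>p. f (p div s) (p mod s)" s m] by simp
qed

definition weight_row :: "nat \<Rightarrow> nat \<Rightarrow> (nat \<Rightarrow> 'a::zero) \<Rightarrow> 'a mat" where
  "weight_row m s a = mat 1 (m * s) (\<lambda>(i, p). if p mod s = 0 then a (p div s) else 0)"

lemma weight_row_carrier: "weight_row m s a \<in> carrier_mat 1 (m * s)"
  by (simp add: weight_row_def)

text \<open>
  Sandwiched between two weight rows, which meet each diagonal block only in its corner, equal blocks
  contribute a common factor, so that only the sum of the products of the weights matters.
\<close>
lemma bordering_replicated_block:
  fixes A :: "'a::comm_semiring_1 mat"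
  assumes A: "A \<in> carrier_mat s s" and ab: "(\<Sum>k<m. a k * b k) = 0"
  shows "weight_row m s a
     * (diag_block_mat (replicate m A) * transpose_mat (weight_row m s b)) = 0\<^sub>m 1 1"
proof (cases "s = 0")
  case True
  then show ?thesis
    using diag_block_replicate_carrier[OF A, of m] weight_row_carrier[of m s a]
    by (intro eq_matI) (auto simp: scalar_prod_def weight_row_def)
next
  case False
  let ?D = "diag_block_mat (replicate m A)" and ?v = "transpose_mat (weight_row m s b)"
  have D: "?D \<in> carrier_mat (m * s) (m * s)" using A by (rule diag_block_replicate_carrier)
  have Dv: "(?D * ?v) $$ (p, 0) = A $$ (p mod s, 0) * b (p div s)" if p: "p < m * s" for p
  proof -
    have pm: "p div s < m" using p by (simp add: less_mult_imp_div_less)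
    have "(?D * ?v) $$ (p, 0) = (\<Sum>r<m * s. ?D $$ (p, r) * ?v $$ (r, 0))"
      using p D weight_row_carrier[of m s b]
      by (simp add: scalar_prod_def lessThan_atLeast0)
    also have "\<dots> = (\<Sum>r<m * s. (if p div s = r div s then A $$ (p mod s, r mod s) else 0)
        * (if r mod s = 0 then b (r div s) else 0))"
      by (rule sum.cong)
        (use p in \<open>auto simp: diag_block_replicate_index[OF A] weight_row_def\<close>)
    also have "\<dots> = (\<Sum>k<m. \<Sum>i<s. (if p div s = k then A $$ (p mod s, i) else 0)
        * (if i = 0 then b k else 0))"
      by (rule sum_div_mod)
    also have "\<dots> = (\<Sum>k<m. if p div s = k then A $$ (p mod s, 0) * b k else 0)"
      using False by (intro sum.cong refl) (auto simp: if_distrib cong: if_cong)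
    also have "\<dots> = A $$ (p mod s, 0) * b (p div s)" using pm by simp
    finally show ?thesis .
  qed
  have "(weight_row m s a * (?D * ?v)) $$ (0, 0)
      = (\<Sum>p<m * s. weight_row m s a $$ (0, p) * (?D * ?v) $$ (p, 0))"
    using D weight_row_carrier[of m s a] weight_row_carrier[of m s b]
    by (simp add: scalar_prod_def lessThan_atLeast0 del: index_mult_mat(1))
      (simp add: scalar_prod_def)
  also have "\<dots> = (\<Sum>p<m * s. (if p mod s = 0 then a (p div s) else 0)
      * (A $$ (p mod s, 0) * b (p div s)))"
    by (rule sum.cong, rule refl, subst Dv) (auto simp: weight_row_def)
  also have "\<dots> = (\<Sum>k<m. \<Sum>i<s. (if i = 0 then a k else 0) * (A $$ (i, 0) * b k))"
    by (rule sum_div_mod)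
  also have "\<dots> = (\<Sum>k<m. A $$ (0, 0) * (a k * b k))"
    using False
    by (intro sum.cong refl) (auto simp: if_distrib if_distribR ac_simps cong: if_cong)
  also have "\<dots> = 0" using ab by (simp add: sum_distrib_left[symmetric])
  finally show ?thesis
    using D weight_row_carrier[of m s a] weight_row_carrier[of m s b]
    by (intro eq_matI) (auto simp del: index_mult_mat(1))
qed

section \<open>Realising the bordered pattern\<close>

lemma bordered_mat_in_pattern_class:
  assumes N: "N \<in> carrier_mat s s" and M: "M \<in> pattern_class N"
    and a: "\<And>k. a k \<noteq> 0" and b: "\<And>k. b k \<noteq> 0"
  shows "four_block_mat (0\<^sub>m 1 1) (weight_row m s a) (transpose_mat (weight_row m s b))
     (diag_block_mat (replicate m M)) \<in> pattern_class (A_pattern m N)"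
proof -
  have M': "M \<in> carrier_mat s s"
    and MN: "\<And>i j. i < s \<Longrightarrow> j < s \<Longrightarrow> M $$ (i,j) \<noteq> 0 \<longleftrightarrow> N $$ (i,j) = Star"
    using M N by (auto simp: pattern_class_def)
  note DM = diag_block_replicate_carrier[OF M', of m]
  note DN = diag_block_replicate_carrier[OF N, of m]
  have blank: "(0 :: entry) \<noteq> Star" by (simp add: zero_entry_def)
  have *: "p mod s < s" if "p < m * s" for p
    using that by (cases s) auto
  have D: "diag_block_mat (replicate m M) $$ (p, r) \<noteq> 0
      \<longleftrightarrow> diag_block_mat (replicate m N) $$ (p, r) = Star" if "p < m * s" "r < m * s" for p r
    using that by (simp add: diag_block_replicate_index[OF M'] diag_block_replicate_index[OF N]
        MN * blank)
  have row: "weight_row m s c $$ (0, p) \<noteq> 0 \<longleftrightarrow> ell_row m s $$ (0, p) = Star"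
    if "p < m * s" "\<And>k. c k \<noteq> 0" for p and c :: "nat \<Rightarrow> real"
    using that by (simp add: weight_row_def ell_row_def ell_def * blank)
  have dims: "dim_row (ell_row m s) = 1" "dim_col (ell_row m s) = m * s"
    by (simp_all add: ell_row_def)
  have "dim_row N = s" using N by simp
  then show ?thesis
    using weight_row_carrier[of m s a] weight_row_carrier[of m s b] DM DN
    unfolding pattern_class_def A_pattern_def
    by (auto simp: dims D row[of _ a, OF _ a] row[of _ b, OF _ b] blank)
qed

theorem theorem2p1:
  fixes N :: pattern and s m :: nat
  assumes "s \<ge> 1"
    and "N \<in> carrier_mat s s"
    and "m \<ge> 2"
    and "potentially_nilpotent N"
  shows "potentially_nilpotent (A_pattern m N)"
proof -
  obtain M k where M: "M \<in> pattern_class N" and nil: "M ^\<^sub>m k = 0\<^sub>m s s"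
    and Mc: "M \<in> carrier_mat s s"
    using assms(2,4) by (auto simp: potentially_nilpotent_def nilpotent_mat_def pattern_class_def)
  define a b :: "nat \<Rightarrow> real" where "a k = 1" and "b k = (if k = 0 then 1 - real m else 1)" for k
  have "(\<Sum>k<m. a k * b k) = (\<Sum>k<m. 1 - (if k = 0 then real m else 0))"
    by (rule sum.cong) (auto simp: a_def b_def)
  also have "\<dots> = 0" using assms(3) by (simp add: sum_subtractf)
  finally have ab: "(\<Sum>k<m. a k * b k) = 0" .
  let ?D = "diag_block_mat (replicate m M)"
  have D: "?D \<in> carrier_mat (m * s) (m * s)" using Mc by (rule diag_block_replicate_carrier)
  have Dpow: "?D ^\<^sub>m j = diag_block_mat (replicate m (M ^\<^sub>m j))" for j
    using diag_block_pow_mat[of "replicate m M" j] Mc by auto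
  have "?D ^\<^sub>m k = 0\<^sub>m (m * s) (m * s)"
  proof (rule eq_matI)
    fix p r assume pr: "p < dim_row (0\<^sub>m (m * s) (m * s))" "r < dim_col (0\<^sub>m (m * s) (m * s))"
    with assms(1) show "(?D ^\<^sub>m k) $$ (p, r) = 0\<^sub>m (m * s) (m * s) $$ (p, r)"
      unfolding Dpow nil by (simp add: diag_block_replicate_index[of _ s])
  qed (use D in auto)
  moreover have "weight_row m s a * (?D ^\<^sub>m j * transpose_mat (weight_row m s b)) = 0\<^sub>m 1 1" for j
    unfolding Dpow using bordering_replicated_block[OF _ ab, of "M ^\<^sub>m j" s] Mc by simp
  moreover have "transpose_mat (weight_row m s b) \<in> carrier_mat (m * s) 1"
    using weight_row_carrier[of m s b] by simp
  ultimately have "nilpotent_mat (four_block_mat (0\<^sub>m 1 1) (weight_row m s a)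
      (transpose_mat (weight_row m s b)) ?D)"
    using nilpotent_bordered_mat[OF D weight_row_carrier] by blast
  moreover have "a k \<noteq> 0" "b k \<noteq> 0" for k using assms(3) by (auto simp: a_def b_def)
  ultimately show ?thesis
    unfolding potentially_nilpotent_def
    using bordered_mat_in_pattern_class[OF assms(2) M] by blast
qed

end
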